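(* Let $\theta$ be an inner function, let $u,v\in H^2$ with $\|u\|=1$ and $S^*v\neq 0$, and let $R_1f=T_\theta f+\langle f,u\rangle v$ on $H^2$. Assume that $\overline{\theta}v\in H^2$ and $1+\langle\overline{\theta}v,u\rangle=0$, so that $M=\ker R_1=\operatorname{span}\{\overline{\theta}v\}$ is a nearly $S^*$-invariant subspace with defect $1$ (defect space $\operatorname{span}\{S^*(\overline{\theta}v)\}$). Put $a_0=\langle\overline{\theta}v,1\rangle$. (1) If $a_0\ne 0$, let $f_0=P_M1=\overline{a_0}\,\|v\|^{-2}\,\overline{\theta}v$; then $M=\{f : f=k_0f_0,\ (k_0,0)\in K\}$ with the $S^*\oplus S^*$-invariant subspace $K=\mathbb{C}\times\{0\}$. (2) If $a_0=0$, then $M=\{f : f=\|S^*(\overline{\theta}v)\|^{-1}k_1\overline{\theta}v,\ k_1\in K\}$ with the $S^*$-invariant subspace $K=\mathbb{C}$.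
   Context: $H^2$ is the Hardy space of the unit disc $\mathbb{D}$, identified via boundary values with a closed subspace of $L^2(\mathbb{T})$; $P:L^2(\mathbb{T})\to H^2$ is the orthogonal projection, $P_M$ the orthogonal projection onto $M$; the Toeplitz operator is $T_gf=P(gf)$. The backward shift is $S^*f(z)=(f(z)-f(0))/z$. An inner function is a bounded analytic function on $\mathbb{D}$ with unimodular boundary values a.e. $\mathbb{C}$ denotes the constant functions in $H^2$; $S^*\oplus S^*$ acts componentwise on $H^2\times H^2$. A subspace $M\subset H^2$ is nearly $S^*$-invariant with defect $m$ if there is an $m$-dimensional subspace $F$ (the defect space) such that $S^*f\in M+F$ whenever $f\in M$ and $f(0)=0$.
   Formalization: If S*(θ̄v)=0 (e.g. θ(z)=v(z)=z, u=−1, so θ̄v=1), span{S*(θ̄v)} is not 1-dimensional; it is claimed 1-dimensional only if S*(θ̄v)≠0, while defect 1 with some 1-dimensional defect space and S*f∈M+span{S*(θ̄v)} are claimed always. *)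

theory Defs
  imports "HOL-Complex_Analysis.Complex_Analysis"
begin

section \<open>The space \<open>L\<^sup>2\<close> of the unit circle\<close>

text \<open>Normalised arc length. The target is the Borel algebra of the circle itself, so that
  measurability and integrals of a function only depend on its values on the circle.\<close>

definition circ :: "complex measure" where
  "circ = distr (uniform_measure lborel {0..2 * pi}) (restrict_space borel (sphere 0 1)) cis"

definition sq_integrable :: "(complex \<Rightarrow> complex) \<Rightarrow> bool" where
  "sq_integrable f \<longleftrightarrow> f \<in> borel_measurable circ \<and> integrable circ (\<lambda>z. (norm (f z))\<^sup>2)"

definition l2_rel :: "(complex \<Rightarrow> complex) \<Rightarrow> (complex \<Rightarrow> complex) \<Rightarrow> bool" where
  "l2_rel f g \<longleftrightarrow> sq_integrable f \<and> sq_integrable g \<and> (AE z in circ. f z = g z)"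

lemma sets_circ: "sets circ = sets (restrict_space borel (sphere 0 1))"
  by (simp add: circ_def)

lemma cis_measurable_circle:
  "cis \<in> measurable (uniform_measure lborel {0..2 * pi}) (restrict_space borel (sphere 0 1))"
proof (rule measurable_restrict_space2)
  show "cis \<in> space (uniform_measure lborel {0..2 * pi}) \<rightarrow> sphere 0 1" by auto
  have "cis \<in> borel_measurable borel"
    by (intro borel_measurable_continuous_onI continuous_intros)
  then show "cis \<in> borel_measurable (uniform_measure lborel {0..2 * pi})"
    by (simp add: measurable_cong_sets[OF sets_uniform_measure refl])
qed

lemma prob_space_circ: "emeasure circ (space circ) = 1"
proof -
  have "emeasure circ (space circ) = 
     emeasure (uniform_measure lborel {0..2 * pi}) (space (uniform_measure lborel {0..2 * pi}))"
    unfolding circ_def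
    by (simp add: emeasure_distr[OF cis_measurable_circle] sets_restrict_space_iff
        space_restrict_space vimage_def)
  also have "\<dots> = 1"
    by (simp add: emeasure_uniform_measure ennreal_divide_self)
  finally show ?thesis .
qed

lemma finite_measure_circ: "finite_measure circ"
  by (rule finite_measureI) (simp add: prob_space_circ)

lemma sq_integrable_const: "sq_integrable (\<lambda>_. c)"
  unfolding sq_integrable_def
  using finite_measure.integrable_const[OF finite_measure_circ] by auto

lemma sq_integrable_dominated:
  assumes "h \<in> borel_measurable circ" "sq_integrable f" "sq_integrable g"
    and "\<And>z. (norm (h z))\<^sup>2 \<le> a * (norm (f z))\<^sup>2 + b * (norm (g z))\<^sup>2"
  shows "sq_integrable h"
  unfolding sq_integrable_def
proof (intro conjI assms(1))
  have "integrable circ (\<lambda>z. a * (norm (f z))\<^sup>2 + b * (norm (g z))\<^sup>2)"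
    using assms(2,3) unfolding sq_integrable_def by auto
  then show "integrable circ (\<lambda>z. (norm (h z))\<^sup>2)"
    by (rule Bochner_Integration.integrable_bound)
       (use assms(1) assms(4) in \<open>auto intro: order_trans[OF assms(4) abs_ge_self]\<close>)
qed

lemma sq_integrable_add:
  assumes "sq_integrable f" "sq_integrable g"
  shows "sq_integrable (\<lambda>z. f z + g z)"
proof (rule sq_integrable_dominated[OF _ assms, of _ 2 2])
  show "(\<lambda>z. f z + g z) \<in> borel_measurable circ"
    using assms unfolding sq_integrable_def by auto
  fix z
  have "(norm (f z + g z))\<^sup>2 \<le> (norm (f z) + norm (g z))\<^sup>2"
    by (intro power_mono norm_triangle_ineq) auto
  also have "\<dots> \<le> 2 * (norm (f z))\<^sup>2 + 2 * (norm (g z))\<^sup>2"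
    using sum_squares_bound[of "norm (f z)" "norm (g z)"] by (simp add: power2_sum)
  finally show "(norm (f z + g z))\<^sup>2 \<le> 2 * (norm (f z))\<^sup>2 + 2 * (norm (g z))\<^sup>2" .
qed

lemma sq_integrable_scale: "sq_integrable f \<Longrightarrow> sq_integrable (\<lambda>z. c * f z)"
  unfolding sq_integrable_def by (auto simp: norm_mult power_mult_distrib)

lemma sq_integrable_uminus: "sq_integrable f \<Longrightarrow> sq_integrable (\<lambda>z. - f z)"
  unfolding sq_integrable_def by auto

lemma sq_integrable_cnj: "sq_integrable f \<Longrightarrow> sq_integrable (\<lambda>z. cnj (f z))"
  unfolding sq_integrable_def
  by (auto intro: borel_measurable_continuous_on[OF continuous_on_cnj[OF continuous_on_id]])

lemma sq_integrable_diff: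
  "sq_integrable f \<Longrightarrow> sq_integrable g \<Longrightarrow> sq_integrable (\<lambda>z. f z - g z)"
  using sq_integrable_add[OF _ sq_integrable_uminus] by force

lemma sq_integrable_inner:
  assumes "sq_integrable f" "sq_integrable g"
  shows "integrable circ (\<lambda>z. f z * cnj (g z))"
proof -
  have m: "f \<in> borel_measurable circ" "(\<lambda>z. cnj (g z)) \<in> borel_measurable circ"
    using assms sq_integrable_cnj[OF assms(2)] unfolding sq_integrable_def by auto
  have "integrable circ (\<lambda>z. (norm (f z))\<^sup>2 + (norm (g z))\<^sup>2)"
    using assms unfolding sq_integrable_def by auto
  then show ?thesis
  proof (rule Bochner_Integration.integrable_bound)
    show "(\<lambda>z. f z * cnj (g z)) \<in> borel_measurable circ" using m by simp
    have "norm (f z) * norm (g z) \<le> (norm (f z))\<^sup>2 + (norm (g z))\<^sup>2" for z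
    proof -
      have "0 \<le> norm (f z) * norm (g z)" by simp
      then show ?thesis using sum_squares_bound[of "norm (f z)" "norm (g z)"] by linarith
    qed
    then show "AE z in circ. norm (f z * cnj (g z)) \<le> norm ((norm (f z))\<^sup>2 + (norm (g z))\<^sup>2)"
      by (auto simp: norm_mult intro!: AE_I2)
  qed
qed

lemma l2_relI:
  assumes "sq_integrable f" "\<And>z. f z = g z"
  shows "l2_rel f g"
proof -
  have "f = g" using assms(2) by blast
  then show ?thesis using assms(1) by (simp add: l2_rel_def)
qed

lemma l2_rel_sq: "l2_rel f g \<Longrightarrow> sq_integrable f"
  by (simp add: l2_rel_def)

lemmas sq_integrable_intros =
  sq_integrable_const sq_integrable_add sq_integrable_diff sq_integrable_uminus
  sq_integrable_scale

quotient_type l2_circle = "complex \<Rightarrow> complex" / partial: l2_rel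
proof (rule part_equivpI)
  show "\<exists>f. l2_rel f f"
    using sq_integrable_const unfolding l2_rel_def by auto
  show "symp l2_rel"
    by (rule sympI) (auto simp: l2_rel_def elim: AE_mp)
  show "transp l2_rel"
  proof (rule transpI)
    fix f g h assume fg: "l2_rel f g" and gh: "l2_rel g h"
    have "AE z in circ. f z = g z" "AE z in circ. g z = h z"
      using fg gh by (auto simp: l2_rel_def)
    then have "AE z in circ. f z = h z" by eventually_elim simp
    then show "l2_rel f h" using fg gh by (auto simp: l2_rel_def)
  qed
qed

lift_definition l2_const :: "complex \<Rightarrow> l2_circle" is "\<lambda>c _. c"
  by (simp add: l2_rel_def sq_integrable_const)

lift_definition l2_scale :: "complex \<Rightarrow> l2_circle \<Rightarrow> l2_circle" (infixr \<open>*\<^sub>C\<close> 75)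
  is "\<lambda>c f z. c * f z"
  by (auto simp: l2_rel_def sq_integrable_scale elim: AE_mp)

lift_definition l2_cnj :: "l2_circle \<Rightarrow> l2_circle" is "\<lambda>f z. cnj (f z)"
  by (auto simp: l2_rel_def sq_integrable_cnj elim: AE_mp)

text \<open>The pointwise product, provided that it is square integrable again, and \<open>0\<close> otherwise. It is
  only used where one factor is essentially bounded, so that the first case applies.\<close>

lift_definition l2_mult :: "l2_circle \<Rightarrow> l2_circle \<Rightarrow> l2_circle" (infixl \<open>\<cdot>\<close> 70)
  is "\<lambda>f g. if sq_integrable (\<lambda>z. f z * g z) then (\<lambda>z. f z * g z) else (\<lambda>_. 0)"
proof -
  fix f f' g g' assume ff: "l2_rel f f'" and gg: "l2_rel g g'"
  have "AE z in circ. f z = f' z" "AE z in circ. g z = g' z"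
    using ff gg by (auto simp: l2_rel_def)
  then have ae: "AE z in circ. f z * g z = f' z * g' z" by eventually_elim simp
  have m: "f \<in> borel_measurable circ" "f' \<in> borel_measurable circ"
    "g \<in> borel_measurable circ" "g' \<in> borel_measurable circ"
    using ff gg by (auto simp: l2_rel_def sq_integrable_def)
  have "integrable circ (\<lambda>z. (norm (f z * g z))\<^sup>2) \<longleftrightarrow> integrable circ (\<lambda>z. (norm (f' z * g' z))\<^sup>2)"
    by (rule integrable_cong_AE) (use ae m in \<open>auto elim: AE_mp\<close>)
  then have "sq_integrable (\<lambda>z. f z * g z) \<longleftrightarrow> sq_integrable (\<lambda>z. f' z * g' z)"
    using m unfolding sq_integrable_def by simp
  then show "l2_rel (if sq_integrable (\<lambda>z. f z * g z) then (\<lambda>z. f z * g z) else (\<lambda>_. 0))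
    (if sq_integrable (\<lambda>z. f' z * g' z) then (\<lambda>z. f' z * g' z) else (\<lambda>_. 0))"
    using ae by (auto simp: l2_rel_def sq_integrable_const)
qed

lift_definition cinner :: "l2_circle \<Rightarrow> l2_circle \<Rightarrow> complex"
  is "\<lambda>f g. (\<integral>z. f z * cnj (g z) \<partial>circ)"
proof -
  fix f f' g g' assume ff: "l2_rel f f'" and gg: "l2_rel g g'"
  have "AE z in circ. f z = f' z" "AE z in circ. g z = g' z"
    using ff gg by (auto simp: l2_rel_def)
  then have ae: "AE z in circ. f z * cnj (g z) = f' z * cnj (g' z)" by eventually_elim simp
  have "integrable circ (\<lambda>z. f z * cnj (g z))" "integrable circ (\<lambda>z. f' z * cnj (g' z))"
    using ff gg sq_integrable_inner unfolding l2_rel_def by auto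
  then show "(\<integral>z. f z * cnj (g z) \<partial>circ) = (\<integral>z. f' z * cnj (g' z) \<partial>circ)"
    by (intro integral_cong_AE ae) auto
qed

text \<open>\<open>F\<close> has radial limits \<open>g\<close> almost everywhere.\<close>

lift_definition has_boundary :: "(complex \<Rightarrow> complex) \<Rightarrow> l2_circle \<Rightarrow> bool"
  is "\<lambda>F g. AE z in circ. ((\<lambda>r. F (of_real r * z)) \<longlongrightarrow> g z) (at_left (1::real))"
proof -
  fix F g g' assume "l2_rel g g'"
  then have "AE z in circ. g z = g' z" by (auto simp: l2_rel_def)
  then have "AE z in circ. ((\<lambda>r. F (of_real r * z)) \<longlongrightarrow> g z) (at_left (1::real)) \<longleftrightarrow>
       ((\<lambda>r. F (of_real r * z)) \<longlongrightarrow> g' z) (at_left (1::real))"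
    by eventually_elim simp
  then show "(AE z in circ. ((\<lambda>r. F (of_real r * z)) \<longlongrightarrow> g z) (at_left (1::real))) =
       (AE z in circ. ((\<lambda>r. F (of_real r * z)) \<longlongrightarrow> g' z) (at_left (1::real)))"
    by (rule eventually_subst)
qed

instantiation l2_circle :: real_vector
begin

lift_definition zero_l2_circle :: l2_circle is "\<lambda>_. 0"
  by (simp add: l2_rel_def sq_integrable_const)

lift_definition plus_l2_circle :: "l2_circle \<Rightarrow> l2_circle \<Rightarrow> l2_circle" is "\<lambda>f g z. f z + g z"
  by (auto simp: l2_rel_def sq_integrable_add elim: AE_mp)

lift_definition minus_l2_circle :: "l2_circle \<Rightarrow> l2_circle \<Rightarrow> l2_circle" is "\<lambda>f g z. f z - g z"
  by (auto simp: l2_rel_def sq_integrable_diff elim: AE_mp)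

lift_definition uminus_l2_circle :: "l2_circle \<Rightarrow> l2_circle" is "\<lambda>f z. - f z"
  by (auto simp: l2_rel_def sq_integrable_uminus elim: AE_mp)

definition "scaleR_l2_circle r (f::l2_circle) = of_real r *\<^sub>C f"
instance
proof
  fix f g h :: l2_circle and a b :: real
  show "f + g + h = f + (g + h)" "f + g = g + f" "0 + f = f" "- f + f = 0" "f - g = f + - g"
    by (transfer; intro l2_relI sq_integrable_intros; (erule l2_rel_sq | simp))+
  show "a *\<^sub>R (f + g) = a *\<^sub>R f + a *\<^sub>R g" "(a + b) *\<^sub>R f = a *\<^sub>R f + b *\<^sub>R f"
    "a *\<^sub>R b *\<^sub>R f = (a * b) *\<^sub>R f" "1 *\<^sub>R f = f"
    unfolding scaleR_l2_circle_def
    by (transfer; intro l2_relI sq_integrable_intros; (erule l2_rel_sq | simp add: algebra_simps))+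
qed

end

instantiation l2_circle :: real_inner
begin

definition "inner_l2_circle (f::l2_circle) g = Re (cinner f g)"
definition "norm_l2_circle (f::l2_circle) = sqrt (Re (cinner f f))"
definition "sgn_l2_circle (f::l2_circle) = f /\<^sub>R norm f"
definition "dist_l2_circle (f::l2_circle) g = norm (f - g)"
definition "uniformity_l2_circle = (INF e\<in>{0<..}. principal {(f::l2_circle, g). dist f g < e})"
definition "open_l2_circle (U::l2_circle set) \<longleftrightarrow>
  (\<forall>f\<in>U. eventually (\<lambda>(f', g). f' = f \<longrightarrow> g \<in> U) uniformity)"

instance
proof
  fix f g h :: l2_circle and a :: real and U :: "l2_circle set"
  show "sgn f = f /\<^sub>R norm f" by (rule sgn_l2_circle_def)
  show "dist f g = norm (f - g)" by (rule dist_l2_circle_def)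
  show "(uniformity :: (l2_circle \<times> l2_circle) filter) =
      (INF e\<in>{0<..}. principal {(f, g). dist f g < e})"
    by (rule uniformity_l2_circle_def)
  show "open U \<longleftrightarrow> (\<forall>f\<in>U. \<forall>\<^sub>F (f', g) in uniformity. f' = f \<longrightarrow> g \<in> U)"
    by (rule open_l2_circle_def)
  show "inner f g = inner g f"
    unfolding inner_l2_circle_def
  proof transfer
    fix f g assume "l2_rel f f" "l2_rel g g"
    then have i: "integrable circ (\<lambda>z. f z * cnj (g z))" "integrable circ (\<lambda>z. g z * cnj (f z))"
      by (auto simp: l2_rel_def sq_integrable_inner)
    show "Re (\<integral>z. f z * cnj (g z) \<partial>circ) = Re (\<integral>z. g z * cnj (f z) \<partial>circ)"
      unfolding integral_Re[OF i(1), symmetric] integral_Re[OF i(2), symmetric]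
      by (intro Bochner_Integration.integral_cong) (auto simp: mult.commute)
  qed
  show "inner (f + g) h = inner f h + inner g h"
    unfolding inner_l2_circle_def
    by transfer (simp add: l2_rel_def sq_integrable_inner distrib_right)
  show "inner (a *\<^sub>R f) g = a * inner f g"
    unfolding inner_l2_circle_def scaleR_l2_circle_def
    by transfer (simp add: mult.assoc)
  have nn: "0 \<le> Re (cinner f f) \<and> (Re (cinner f f) = 0 \<longleftrightarrow> f = 0)"
  proof transfer
    fix f assume "l2_rel f f"
    then have s: "sq_integrable f" by (simp add: l2_rel_def)
    have *: "Re (\<integral>z. f z * cnj (f z) \<partial>circ) = (\<integral>z. (norm (f z))\<^sup>2 \<partial>circ)"
      unfolding integral_Re[OF sq_integrable_inner[OF s s], symmetric]
      by (intro Bochner_Integration.integral_cong refl)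
        (simp add: cmod_power2 flip: power2_eq_square)
    have "(\<integral>z. (norm (f z))\<^sup>2 \<partial>circ) = 0 \<longleftrightarrow> (AE z in circ. (norm (f z))\<^sup>2 = 0)"
      using s unfolding sq_integrable_def by (intro integral_nonneg_eq_0_iff_AE) auto
    then show "0 \<le> Re (\<integral>z. f z * cnj (f z) \<partial>circ) \<and>
        (Re (\<integral>z. f z * cnj (f z) \<partial>circ) = 0 \<longleftrightarrow> l2_rel f (\<lambda>_. 0))"
      unfolding * using s by (auto simp: l2_rel_def sq_integrable_const)
  qed
  show "0 \<le> inner f f" "inner f f = 0 \<longleftrightarrow> f = 0"
    using nn by (simp_all add: inner_l2_circle_def)
  show "norm f = sqrt (inner f f)" by (simp add: norm_l2_circle_def inner_l2_circle_def)
qed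

end

interpretation L2: vector_space l2_scale
  by unfold_locales
    (transfer; intro l2_relI sq_integrable_intros; (erule l2_rel_sq | simp add: algebra_simps))+

definition pair_scale :: "complex \<Rightarrow> l2_circle \<times> l2_circle \<Rightarrow> l2_circle \<times> l2_circle" where
  "pair_scale c p = (c *\<^sub>C fst p, c *\<^sub>C snd p)"

interpretation L2_pair: vector_space pair_scale
  by unfold_locales
    (auto simp: pair_scale_def L2.scale_right_distrib L2.scale_left_distrib)

text \<open>The orthogonal projection onto a closed subspace.\<close>

definition orth_proj :: "l2_circle set \<Rightarrow> l2_circle \<Rightarrow> l2_circle" where
  "orth_proj M f = (THE h. h \<in> M \<and> (\<forall>k\<in>M. cinner (f - h) k = 0))"

definition has_dim :: "l2_circle set \<Rightarrow> nat \<Rightarrow> bool" where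
  "has_dim F m \<longleftrightarrow> (\<exists>B. finite B \<and> card B = m \<and> L2.independent B \<and> L2.span B = F)"


section \<open>The Hardy space and operators on it\<close>

definition hardy_disc :: "(complex \<Rightarrow> complex) set" where
  "hardy_disc = {F. F holomorphic_on ball 0 1 \<and>
     (\<exists>C. \<forall>r\<in>{0..<1}. (\<integral>z. (norm (F (of_real r * z)))\<^sup>2 \<partial>circ) \<le> C)}"

text \<open>The Hardy space as a subspace of \<open>L\<^sup>2\<close>, by identification of a function on the disc with
  its boundary values. An element \<open>f\<close> of \<open>H2\<close> is the boundary function of \<open>disc_fun f\<close>, whose
  values are determined on the open disc only.\<close>

definition H2 :: "l2_circle set" where
  "H2 = {f. \<exists>F\<in>hardy_disc. has_boundary F f}"

definition disc_fun :: "l2_circle \<Rightarrow> complex \<Rightarrow> complex" where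
  "disc_fun f = (SOME F. F \<in> hardy_disc \<and> has_boundary F f)"

definition boundary :: "(complex \<Rightarrow> complex) \<Rightarrow> l2_circle" where
  "boundary F = (THE f. has_boundary F f)"

definition inner_function :: "(complex \<Rightarrow> complex) \<Rightarrow> bool" where
  "inner_function \<theta> \<longleftrightarrow> \<theta> holomorphic_on ball 0 1 \<and> bounded (\<theta> ` ball 0 1) \<and>
     (AE z in circ. \<exists>l. norm l = 1 \<and> ((\<lambda>r. \<theta> (of_real r * z)) \<longlongrightarrow> l) (at_left (1::real)))"

definition toeplitz :: "l2_circle \<Rightarrow> l2_circle \<Rightarrow> l2_circle" where
  "toeplitz g f = orth_proj H2 (g \<cdot> f)"

text \<open>The backward shift; the value at \<open>0\<close> removes the singularity of the difference quotient.\<close>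

definition bshift :: "l2_circle \<Rightarrow> l2_circle" where
  "bshift f = boundary (\<lambda>z. if z = 0 then deriv (disc_fun f) 0
                            else (disc_fun f z - disc_fun f 0) / z)"

definition closed_subspace_H2 :: "l2_circle set \<Rightarrow> bool" where
  "closed_subspace_H2 M \<longleftrightarrow> M \<subseteq> H2 \<and> L2.subspace M \<and> closed M"

definition bshift_invariant_subspace :: "l2_circle set \<Rightarrow> bool" where
  "bshift_invariant_subspace K \<longleftrightarrow> closed_subspace_H2 K \<and> (\<forall>k\<in>K. bshift k \<in> K)"

definition bshift2_invariant_subspace :: "(l2_circle \<times> l2_circle) set \<Rightarrow> bool" where
  "bshift2_invariant_subspace K \<longleftrightarrow>
     K \<subseteq> H2 \<times> H2 \<and> L2_pair.subspace K \<and> closed K \<and> (\<forall>(k, l)\<in>K. (bshift k, bshift l) \<in> K)"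

definition nearly_invariant_modulo :: "l2_circle set \<Rightarrow> l2_circle set \<Rightarrow> bool" where
  "nearly_invariant_modulo M F \<longleftrightarrow> closed_subspace_H2 M \<and> F \<subseteq> H2 \<and> L2.subspace F \<and>
     (\<forall>f\<in>M. disc_fun f 0 = 0 \<longrightarrow> (\<exists>g\<in>M. \<exists>h\<in>F. bshift f = g + h))"

definition nearly_invariant_with_defect :: "l2_circle set \<Rightarrow> nat \<Rightarrow> bool" where
  "nearly_invariant_with_defect M m \<longleftrightarrow> (\<exists>F. has_dim F m \<and> nearly_invariant_modulo M F)"

end

theory Submission
  imports Defs
begin

text \<open>
  Boundary values of an inner function are unimodular, so \<open>\<theta>\<close> acts on \<open>H2\<close> as an isometry with
  left inverse multiplication by the conjugate of \<open>\<theta>\<close>, and the Toeplitz operator with symbol \<open>\<theta>\<close>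
  is plain multiplication, because \<open>\<theta>\<close> maps \<open>H2\<close> into itself. Hence \<open>R\<^sub>1 f = 0\<close> says
  \<open>\<theta> f = - \<langle>f, u\<rangle> v\<close>, that is \<open>f = - \<langle>f, u\<rangle> w\<close>; so \<open>f\<close> is a multiple of \<open>w\<close>, and conversely every
  multiple of \<open>w\<close> solves the equation since \<open>\<langle>w, u\<rangle> = -1\<close> (\<open>toeplitz_perturbation_kernel\<close>). All
  other claims are about the line spanned by \<open>w\<close>: projecting onto it is the usual formula, where
  \<open>\<parallel>w\<parallel> = \<parallel>v\<parallel>\<close>, and multiplying by constant functions is scaling.

  The analytic content is the description of the backward shift on boundary functions: \<open>S\<^sup>* f\<close>
  is \<open>(f - \<langle>f, 1\<rangle>) / z\<close> (\<open>bshift_eq\<close>). It shows that \<open>S\<^sup>*\<close> is homogeneous, kills the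
  constants and preserves the norm of functions orthogonal to \<open>1\<close>; in particular \<open>S\<^sup>* w \<noteq> 0\<close> when
  \<open>a\<^sub>0 = 0\<close>. What has to be proved for it is \<open>F 0 = \<langle>f, 1\<rangle>\<close> for a Hardy function \<open>F\<close> with boundary
  function \<open>f\<close> (\<open>hardy_disc_value_0\<close>). The value \<open>F 0\<close> is the mean of \<open>F\<close> over each circle of
  radius \<open>r < 1\<close>, and boundedness in \<open>L\<^sup>2\<close> makes the functions \<open>F (r z)\<close> uniformly integrable, so that
  their almost everywhere convergence gives convergence of the means to that of \<open>f\<close>.
\<close>

section \<open>Linear algebra of the complex inner product\<close>

lemma l2_sq_integrable_product:
  "l2_rel f f \<Longrightarrow> l2_rel g g \<Longrightarrow> integrable circ (\<lambda>z. f z * cnj (g z))"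
  by (auto simp: l2_rel_def sq_integrable_inner)

lemma cinner_diff_left: "cinner (f - g) k = cinner f k - cinner g k"
  by transfer (simp add: l2_sq_integrable_product left_diff_distrib)

lemma cinner_scale_left: "cinner (c *\<^sub>C f) g = c * cinner f g"
  by (transfer fixing: c) (simp add: mult.assoc)

lemma cinner_commute: "cinner f g = cnj (cinner g f)"
proof transfer
  fix f g :: "complex \<Rightarrow> complex"
  show "(\<integral>z. f z * cnj (g z) \<partial>circ) = cnj (\<integral>z. g z * cnj (f z) \<partial>circ)"
    unfolding Bochner_Integration.integral_cnj[symmetric] by (simp add: mult.commute)
qed

lemma cinner_scale_right: "cinner f (c *\<^sub>C g) = cnj c * cinner f g"
  using cinner_commute[of f "c *\<^sub>C g"] cinner_commute[of f g] by (simp add: cinner_scale_left)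

lemma cinner_self: "cinner f f = of_real ((norm f)\<^sup>2)"
proof -
  have "Im (cinner f f) = 0"
    using arg_cong[OF cinner_commute[of f f], of Im] by simp
  moreover have "Re (cinner f f) = (norm f)\<^sup>2"
    by (simp add: power2_norm_eq_inner inner_l2_circle_def)
  ultimately show ?thesis by (simp add: complex_eq_iff)
qed

text \<open>Reduces continuity of the complex inner product to that of the real one.\<close>

lemma cinner_eq_inner: "cinner f g = Complex (inner f g) (inner f (\<i> *\<^sub>C g))"
  by (simp add: inner_l2_circle_def cinner_scale_right)

lemma l2_scale_eq_scaleR: "c *\<^sub>C f = Re c *\<^sub>R f + Im c *\<^sub>R (\<i> *\<^sub>C f)"
proof -
  have "c *\<^sub>C f = (of_real (Re c) + of_real (Im c) * \<i>) *\<^sub>C f"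
    by (metis complex_eq mult.commute)
  then show ?thesis
    unfolding scaleR_l2_circle_def by (simp only: L2.scale_left_distrib L2.scale_scale)
qed

text \<open>The complex line is the set of fixed points of the projection onto it, which is continuous.\<close>

lemma closed_span_singleton: "closed (L2.span {w})"
proof (cases "w = 0")
  case False
  let ?c = "\<lambda>f. cinner f w / of_real ((norm w)\<^sup>2)"
  have "f \<in> L2.span {w} \<longleftrightarrow> f = ?c f *\<^sub>C w" for f
  proof
    assume "f \<in> L2.span {w}"
    then obtain k where "f = k *\<^sub>C w" by (auto simp: L2.span_singleton)
    then show "f = ?c f *\<^sub>C w"
      using False by (simp add: cinner_scale_left cinner_self)
  next
    assume "f = ?c f *\<^sub>C w"
    then show "f \<in> L2.span {w}" unfolding L2.span_singleton by blast
  qed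
  then have "L2.span {w} = {f. f = ?c f *\<^sub>C w}" by blast
  moreover have "closed {f. f = ?c f *\<^sub>C w}"
    unfolding cinner_eq_inner
    by (subst (2) l2_scale_eq_scaleR)
      (use False in \<open>auto intro!: closed_Collect_eq continuous_intros\<close>)
  ultimately show ?thesis by simp
qed simp

lemma orth_proj_eqI:
  assumes "L2.subspace N" "h \<in> N" "\<And>k. k \<in> N \<Longrightarrow> cinner (f - h) k = 0"
  shows "orth_proj N f = h"
  unfolding orth_proj_def
proof (rule the_equality)
  fix g assume g: "g \<in> N \<and> (\<forall>k\<in>N. cinner (f - g) k = 0)"
  then have d: "g - h \<in> N" using assms by (intro L2.subspace_diff) auto
  have "cinner (g - h) (g - h) = cinner (f - h) (g - h) - cinner (f - g) (g - h)"
    by (simp flip: cinner_diff_left)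
  also have "\<dots> = 0" using g d assms(3) by auto
  finally show "g = h" by (simp add: cinner_self)
qed (use assms in auto)

lemma orth_proj_mem:
  assumes "L2.subspace N" "f \<in> N"
  shows "orth_proj N f = f"
proof (rule orth_proj_eqI[OF assms])
  fix k
  have "cinner (0 *\<^sub>C f) k = 0" unfolding cinner_scale_left by simp
  then show "cinner (f - f) k = 0" by simp
qed

lemma orth_proj_span_singleton:
  "orth_proj (L2.span {w}) f = (cinner f w / of_real ((norm w)\<^sup>2)) *\<^sub>C w"
proof (rule orth_proj_eqI)
  fix k assume "k \<in> L2.span {w}"
  then obtain c where "k = c *\<^sub>C w" by (auto simp: L2.span_singleton)
  then show "cinner (f - (cinner f w / of_real ((norm w)\<^sup>2)) *\<^sub>C w) k = 0"
    by (cases "w = 0")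
      (auto simp: cinner_diff_left cinner_scale_left cinner_scale_right cinner_self
        cinner_commute[of f 0] cinner_scale_left[of 0 0, simplified])
qed (auto intro: L2.span_base L2.span_scale)

lemma l2_const_mult: "l2_const c \<cdot> f = c *\<^sub>C f"
  by (transfer fixing: c) (auto simp: l2_rel_def sq_integrable_scale)

lemma l2_const_eq_scale: "l2_const c = c *\<^sub>C l2_const 1"
  by (transfer fixing: c) (auto simp: l2_rel_def sq_integrable_const)

lemma l2_const_0: "l2_const 0 = 0"
  using l2_const_eq_scale[of 0] by simp

lemma range_l2_const: "range l2_const = L2.span {l2_const 1}"
  unfolding L2.span_singleton by (simp flip: l2_const_eq_scale)

lemma norm_l2_const_1: "norm (l2_const 1) = 1"
proof -
  have "cinner (l2_const 1) (l2_const 1) = 1"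
    by transfer (simp add: measure_def prob_space_circ)
  then show ?thesis by (simp add: norm_l2_circle_def)
qed

lemma has_dim_span_singleton: "x \<noteq> 0 \<Longrightarrow> has_dim (L2.span {x}) 1"
  unfolding has_dim_def by (intro exI[of _ "{x}"]) (simp add: L2.dependent_single)

section \<open>Integration on the circle\<close>

lemma space_circ: "space circ = sphere 0 1"
  by (simp add: circ_def space_restrict_space)

lemma AE_circ_norm: "AE z in circ. norm z = 1"
  by (rule AE_I2) (simp add: space_circ)

lemma borel_measurable_circ_continuous:
  fixes f :: "complex \<Rightarrow> complex"
  shows "continuous_on (sphere 0 1) f \<Longrightarrow> f \<in> borel_measurable circ"
  using borel_measurable_continuous_on_restrict[of "sphere 0 1" f]
  by (simp add: measurable_cong_sets[OF sets_circ refl])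

lemma sq_integrable_AE_bounded:
  assumes "f \<in> borel_measurable circ" "AE z in circ. norm (f z) \<le> B"
  shows "sq_integrable f"
  unfolding sq_integrable_def
proof
  have "AE z in circ. norm ((norm (f z))\<^sup>2) \<le> B\<^sup>2"
    using assms(2) by eventually_elim (simp add: power_mono)
  then show "integrable circ (\<lambda>z. (norm (f z))\<^sup>2)"
    using assms(1) by (intro finite_measure.integrable_const_bound[OF finite_measure_circ]) auto
qed (fact assms(1))

lemma sq_integrable_continuous:
  assumes "continuous_on (sphere 0 1) f"
  shows "sq_integrable f"
proof -
  obtain B where "\<forall>z\<in>sphere 0 1. norm (f z) \<le> B"
    using compact_imp_bounded[OF compact_continuous_image[OF assms compact_sphere]]
    by (auto simp: bounded_iff)
  then show ?thesis
    using borel_measurable_circ_continuous[OF assms]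
    by (intro sq_integrable_AE_bounded[of _ B] AE_I2) (auto simp: space_circ)
qed

lemma sq_integrable_integrable:
  assumes "sq_integrable f" shows "integrable circ f"
  using sq_integrable_inner[OF assms sq_integrable_const[of 1]] by simp

lemma continuous_on_dilate:
  assumes "F holomorphic_on ball 0 1" "0 \<le> r" "r < 1"
  shows "continuous_on (sphere 0 1) (\<lambda>z. F (of_real r * z))"
  by (rule continuous_on_compose2[OF holomorphic_on_imp_continuous_on[OF assms(1)]])
    (use assms in \<open>auto intro!: continuous_intros simp: norm_mult\<close>)

text \<open>This form connects the Lebesgue integral on the circle to the gauge integrals in which contour
  integrals are defined.\<close>

lemma integral_circ_eq:
  fixes g :: "complex \<Rightarrow> complex"
  assumes "continuous_on (sphere 0 1) g"
  shows "(\<integral>z. g z \<partial>circ) = integral {0..2*pi} (\<lambda>t. g (cis t)) / (2 * pi)"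
proof -
  have c: "continuous_on {0..2*pi} (\<lambda>t. g (cis t))"
    by (rule continuous_on_compose2[OF assms]) (auto intro!: continuous_intros)
  let ?U = "uniform_measure lborel {0..2*pi}"
  have "(\<integral>z. g z \<partial>circ) = (\<integral>t. g (cis t) \<partial>?U)"
    unfolding circ_def
    by (rule integral_distr[OF cis_measurable_circle])
      (rule borel_measurable_continuous_on_restrict[OF assms])
  also have "?U = density lborel (\<lambda>t. ennreal (indicator {0..2*pi} t / (2*pi)))"
    unfolding uniform_measure_def
    by (rule arg_cong[where f="density lborel"], rule ext)
      (simp add: divide_ennreal flip: ennreal_indicator)
  also have "(\<integral>t. g (cis t) \<partial>\<dots>) = (\<integral>t. (indicator {0..2*pi} t / (2*pi)) *\<^sub>R g (cis t) \<partial>lborel)"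
    by (rule integral_density)
      (auto intro!: borel_measurable_continuous_onI continuous_on_compose2[OF assms]
        continuous_intros)
  also have "\<dots> = (\<integral>t. (1/(2*pi)) *\<^sub>R (indicator {0..2*pi} t *\<^sub>R g (cis t)) \<partial>lborel)"
    by simp
  also have "\<dots> = (1/(2*pi)) *\<^sub>R (LINT t:{0..2*pi}|lborel. g (cis t))"
    unfolding set_lebesgue_integral_def by (rule integral_scaleR_right)
  also have "\<dots> = integral {0..2*pi} (\<lambda>t. g (cis t)) / (2*pi)"
    using set_borel_integral_eq_integral(2)[OF borel_integrable_atLeastAtMost'[OF c]]
    by (simp add: scaleR_conv_of_real)
  finally show ?thesis .
qed

lemma circ_mean_value:
  assumes "F holomorphic_on ball 0 1" "0 \<le> r" "r < 1"
  shows "(\<integral>z. F (of_real r * z) \<partial>circ) = F 0"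
proof (cases "r = 0")
  case True
  then show ?thesis using prob_space_circ by (simp add: measure_def)
next
  case False
  with assms have r: "0 < r" "cball 0 r \<subseteq> ball (0::complex) 1" by auto
  have "((\<lambda>u. F u / (u - 0)) has_contour_integral 2 * of_real pi * \<i> * F 0) (circlepath 0 r)"
    using r by (intro Cauchy_integral_circlepath_simple holomorphic_on_subset[OF assms(1)]) auto
  then have "((\<lambda>t. F (circlepath 0 r t) / circlepath 0 r t * (of_real (2*pi) * \<i> * of_real r *
      exp (2 * of_real pi * \<i> * of_real t))) has_integral 2 * of_real pi * \<i> * F 0) {0..1}"
    unfolding has_contour_integral_def
    by (rule has_integral_eq[rotated]) (simp add: vector_derivative_circlepath01)
  then have "((\<lambda>t. (2 * of_real pi * \<i>) * F (of_real r * cis (2 * pi * t)))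
      has_integral 2 * of_real pi * \<i> * F 0) {0..1}"
    by (rule has_integral_eq[rotated])
      (use r in \<open>simp add: circlepath cis_conv_exp mult_ac\<close>)
  from has_integral_mult_right[OF this, of "1 / (2 * of_real pi * \<i>)"]
  have "((\<lambda>t. F (of_real r * cis (2 * pi * t))) has_integral F 0) {0..1}" by simp
  from has_integral_stretch_real[OF this, of "1 / (2*pi)"]
  have "((\<lambda>t. F (of_real r * cis t)) has_integral (2 * pi) *\<^sub>R F 0) {0..2*pi}"
    by (simp add: image_mult_atLeastAtMost_if' mult.commute)
  then show ?thesis
    using integral_circ_eq[OF continuous_on_dilate[OF assms]]
    by (simp add: integral_unique scaleR_conv_of_real)
qed

text \<open>A bound in \<open>L\<^sup>2\<close> replaces a dominating function: beyond the height \<open>N\<close> the functions carry mass at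
  most \<open>D / N\<close>, since there \<open>\<bar>h\<bar> \<le> \<bar>h\<bar>\<^sup>2 / N\<close>, and below it they converge by domination.\<close>

lemma L2_bounded_AE_tendsto_integral:
  fixes h :: "nat \<Rightarrow> 'a \<Rightarrow> complex"
  assumes M: "finite_measure M"
    and int: "\<And>n. integrable M (h n)" "\<And>n. integrable M (\<lambda>x. (norm (h n x))\<^sup>2)"
    and bound: "\<And>n. (\<integral>x. (norm (h n x))\<^sup>2 \<partial>M) \<le> D"
    and lim: "AE x in M. (\<lambda>n. h n x) \<longlonglongrightarrow> 0"
  shows "(\<lambda>n. \<integral>x. h n x \<partial>M) \<longlonglongrightarrow> 0"
proof (rule LIMSEQ_I)
  fix e :: real assume e: "0 < e"
  have D: "0 \<le> D" using order_trans[OF integral_nonneg_AE bound[of 0]] by simp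
  \<comment> \<open>The height is chosen to make the mass above it less than half of \<open>e\<close>; the summand \<open>1\<close> keeps \<open>N\<close>
    positive when \<open>D = 0\<close>.\<close>
  define N where "N = 2 * (D + 1) / e"
  have N: "N > 0" using e D by (simp add: N_def)
  have m: "h n \<in> borel_measurable M" for n using int(1) by auto
  have i_min: "integrable M (\<lambda>x. min (norm (h n x)) N)" for n
    using N m by (intro finite_measure.integrable_const_bound[OF M, of _ N]) auto
  have "(\<lambda>n. \<integral>x. min (norm (h n x)) N \<partial>M) \<longlonglongrightarrow> (\<integral>x. 0 \<partial>M)"
  proof (rule integral_dominated_convergence[where w="\<lambda>_. N"])
    show "AE x in M. (\<lambda>n. min (norm (h n x)) N) \<longlonglongrightarrow> 0"
      using lim
    proof eventually_elim
      fix x assume "(\<lambda>n. h n x) \<longlonglongrightarrow> 0"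
      then show "(\<lambda>n. min (norm (h n x)) N) \<longlonglongrightarrow> 0"
        using tendsto_min[OF tendsto_norm tendsto_const, of _ _ _ N] N by fastforce
    qed
    show "integrable M (\<lambda>_. N)" by (rule finite_measure.integrable_const[OF M])
  qed (use N m in auto)
  from LIMSEQ_D[OF this, of "e/2"] e obtain n0
    where n0: "\<And>n. n \<ge> n0 \<Longrightarrow> (\<integral>x. min (norm (h n x)) N \<partial>M) < e / 2" by fastforce
  show "\<exists>n0. \<forall>n\<ge>n0. norm ((\<integral>x. h n x \<partial>M) - 0) < e"
  proof (intro exI allI impI)
    fix n assume n: "n0 \<le> n"
    have pw: "norm (h n x) \<le> min (norm (h n x)) N + (norm (h n x))\<^sup>2 / N" for x
    proof (cases "norm (h n x) \<le> N")
      case False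
      then have "norm (h n x) \<le> (norm (h n x))\<^sup>2 / N"
        using N by (simp add: power2_eq_square pos_le_divide_eq mult_left_mono)
      then show ?thesis using N by (simp add: min_def)
    qed (use N in simp)
    have "norm (\<integral>x. h n x \<partial>M) \<le> (\<integral>x. norm (h n x) \<partial>M)" by (rule integral_norm_bound)
    also have "\<dots> \<le> (\<integral>x. min (norm (h n x)) N + (norm (h n x))\<^sup>2 / N \<partial>M)"
      by (rule integral_mono) (use int i_min pw in auto)
    also have "\<dots> = (\<integral>x. min (norm (h n x)) N \<partial>M) + (\<integral>x. (norm (h n x))\<^sup>2 \<partial>M) / N"
      using int i_min by simp
    also have "\<dots> < e / 2 + D / N + 1 / N"
      using n0[OF n] bound[of n] N by (smt (verit) divide_right_mono zero_less_divide_1_iff)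
    also have "\<dots> = e / 2 + (D + 1) / N" by (simp add: add_divide_distrib)
    also have "(D + 1) / N = e / 2"
    proof -
      have "N * (e / 2) = D + 1" using e by (simp add: N_def)
      then show ?thesis using N by (simp add: field_simps)
    qed
    finally show "norm ((\<integral>x. h n x \<partial>M) - 0) < e" by simp
  qed
qed

section \<open>Radial boundary values\<close>

lemma has_boundary_unique:
  assumes "has_boundary F f" "has_boundary F g"
  shows "f = g"
  using assms
proof (transfer fixing: F)
  fix f g
  assume "l2_rel f f" "l2_rel g g"
    and *: "AE z in circ. ((\<lambda>r. F (of_real r * z)) \<longlongrightarrow> f z) (at_left (1::real))"
    "AE z in circ. ((\<lambda>r. F (of_real r * z)) \<longlongrightarrow> g z) (at_left (1::real))"
  have "AE z in circ. f z = g z"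
    using * by eventually_elim (rule tendsto_unique[OF trivial_limit_at_left_real])
  then show "l2_rel f g" using \<open>l2_rel f f\<close> \<open>l2_rel g g\<close> by (simp add: l2_rel_def)
qed

lemma boundary_eqI: "has_boundary F f \<Longrightarrow> boundary F = f"
  unfolding boundary_def by (blast intro: has_boundary_unique)

lemma has_boundary_add:
  assumes "has_boundary F f" "has_boundary G g"
  shows "has_boundary (\<lambda>z. F z + G z) (f + g)"
  using assms by (transfer fixing: F G) (elim AE_mp, auto intro!: AE_I2 tendsto_intros)

lemma has_boundary_scale:
  assumes "has_boundary F f"
  shows "has_boundary (\<lambda>z. c * F z) (c *\<^sub>C f)"
  using assms by (transfer fixing: F c) (elim AE_mp, auto intro!: AE_I2 tendsto_intros)

lemma has_boundary_const: "has_boundary (\<lambda>_. c) (l2_const c)"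
  by (transfer fixing: c) simp

section \<open>Hardy functions on the disc\<close>

lemma norm_add_sq_le: "(norm (x + y))\<^sup>2 \<le> 2 * (norm x)\<^sup>2 + 2 * (norm (y::complex))\<^sup>2"
proof -
  have "(norm (x + y))\<^sup>2 \<le> (norm x + norm y)\<^sup>2"
    by (intro power_mono norm_triangle_ineq) auto
  then show ?thesis
    using sum_squares_bound[of "norm x" "norm y"] by (simp add: power2_sum)
qed

lemma sq_integrable_dilate:
  assumes "F holomorphic_on ball 0 1" "0 \<le> r" "r < 1"
  shows "sq_integrable (\<lambda>z. F (of_real r * z))"
  by (intro sq_integrable_continuous continuous_on_dilate assms)

lemma hardy_discD:
  assumes "F \<in> hardy_disc"
  obtains C where "F holomorphic_on ball 0 1"
    "\<And>r. 0 \<le> r \<Longrightarrow> r < 1 \<Longrightarrow> (\<integral>z. (norm (F (of_real r * z)))\<^sup>2 \<partial>circ) \<le> C"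
proof -
  from assms obtain C where "F holomorphic_on ball 0 1"
      "\<forall>r\<in>{0..<1}. (\<integral>z. (norm (F (of_real r * z)))\<^sup>2 \<partial>circ) \<le> C"
    unfolding hardy_disc_def by blast
  then show ?thesis by (intro that[of C]) auto
qed

text \<open>The common source of the closure properties of the class: the bound on the means over circles is
  inherited from a pointwise bound on the disc.\<close>

lemma hardy_disc_dominated:
  assumes H: "H holomorphic_on ball 0 1" and FG: "F \<in> hardy_disc" "G \<in> hardy_disc"
    and le: "\<And>z. norm z < 1 \<Longrightarrow>
      (norm (H z))\<^sup>2 \<le> a * (norm (F z))\<^sup>2 + b * (norm (G z))\<^sup>2"
    and ab: "0 \<le> a" "0 \<le> b"
  shows "H \<in> hardy_disc"
proof -
  obtain C D where C: "F holomorphic_on ball 0 1"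
      "\<And>r. 0 \<le> r \<Longrightarrow> r < 1 \<Longrightarrow> (\<integral>z. (norm (F (of_real r * z)))\<^sup>2 \<partial>circ) \<le> C"
    and D: "G holomorphic_on ball 0 1"
      "\<And>r. 0 \<le> r \<Longrightarrow> r < 1 \<Longrightarrow> (\<integral>z. (norm (G (of_real r * z)))\<^sup>2 \<partial>circ) \<le> D"
    using hardy_discD[OF FG(1)] hardy_discD[OF FG(2)] by metis
  have "(\<integral>z. (norm (H (of_real r * z)))\<^sup>2 \<partial>circ) \<le> a * C + b * D" if r: "0 \<le> r" "r < 1" for r
  proof -
    have i: "integrable circ (\<lambda>z. (norm (K (of_real r * z)))\<^sup>2)"
      if "K holomorphic_on ball 0 1" for K
      using sq_integrable_dilate[OF that r] by (simp add: sq_integrable_def)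
    have "(\<integral>z. (norm (H (of_real r * z)))\<^sup>2 \<partial>circ) \<le>
        (\<integral>z. a * (norm (F (of_real r * z)))\<^sup>2 + b * (norm (G (of_real r * z)))\<^sup>2 \<partial>circ)"
      using i[OF H] i[OF C(1)] i[OF D(1)] r
      by (intro integral_mono le) (auto simp: space_circ norm_mult)
    also have "\<dots> = a * (\<integral>z. (norm (F (of_real r * z)))\<^sup>2 \<partial>circ)
        + b * (\<integral>z. (norm (G (of_real r * z)))\<^sup>2 \<partial>circ)"
      using i[OF C(1)] i[OF D(1)] by simp
    also have "\<dots> \<le> a * C + b * D"
      using C(2)[OF r] D(2)[OF r] ab by (intro add_mono mult_left_mono)
    finally show ?thesis .
  qed
  then show ?thesis using H unfolding hardy_disc_def by fastforce
qed

lemma hardy_disc_const: "(\<lambda>_. c) \<in> hardy_disc"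
  unfolding hardy_disc_def by auto

lemma hardy_disc_add: "F \<in> hardy_disc \<Longrightarrow> G \<in> hardy_disc \<Longrightarrow> (\<lambda>z. F z + G z) \<in> hardy_disc"
  by (rule hardy_disc_dominated[of _ F G 2 2])
    (auto simp: norm_add_sq_le hardy_disc_def intro!: holomorphic_intros)

lemma hardy_disc_mult_bounded:
  assumes "G holomorphic_on ball 0 1" "\<And>z. norm z < 1 \<Longrightarrow> norm (G z) \<le> B" "F \<in> hardy_disc"
  shows "(\<lambda>z. G z * F z) \<in> hardy_disc"
proof (rule hardy_disc_dominated[OF _ assms(3,3), of _ "B\<^sup>2" 0])
  show "(\<lambda>z. G z * F z) holomorphic_on ball 0 1"
    using assms by (auto simp: hardy_disc_def intro!: holomorphic_intros)
  fix z :: complex assume "norm z < 1"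
  then have "(norm (G z))\<^sup>2 \<le> B\<^sup>2" using assms(2) by (intro power_mono) auto
  then show "(norm (G z * F z))\<^sup>2 \<le> B\<^sup>2 * (norm (F z))\<^sup>2 + 0 * (norm (F z))\<^sup>2"
    by (simp add: norm_mult power_mult_distrib mult_right_mono)
qed auto

text \<open>Division by \<open>z\<close> costs at most a factor \<open>2\<close> away from the disc of radius \<open>1/2\<close>, and on that disc the
  quotient, continued over \<open>0\<close>, is bounded by compactness.\<close>

lemma hardy_disc_difference_quotient:
  assumes F: "F \<in> hardy_disc"
  shows "(\<lambda>z. if z = 0 then deriv F 0 else (F z - F 0) / z) \<in> hardy_disc"
    (is "?G \<in> _")
proof -
  have "F holomorphic_on ball 0 1" using F by (simp add: hardy_disc_def)
  from pole_lemma_open[OF this open_ball, of 0] have G: "?G holomorphic_on ball 0 1"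
    unfolding diff_zero .
  have "continuous_on (cball 0 (1/2)) ?G"
    by (rule continuous_on_subset[OF holomorphic_on_imp_continuous_on[OF G]]) auto
  from compact_imp_bounded[OF compact_continuous_image[OF this compact_cball]]
  obtain B where "\<forall>y\<in>?G ` cball 0 (1/2). norm y \<le> B" unfolding bounded_iff by blast
  then have B: "norm (?G z) \<le> B" if "norm z \<le> 1/2" for z
    using that by (elim ballE[of _ _ "?G z"]) auto
  \<comment> \<open>A constant function absorbs both the bound near \<open>0\<close> and the value subtracted away from \<open>0\<close>.\<close>
  let ?K = "\<lambda>_::complex. complex_of_real (sqrt (B\<^sup>2 + 8 * (norm (F 0))\<^sup>2))"
  have K: "(norm (?K z))\<^sup>2 = B\<^sup>2 + 8 * (norm (F 0))\<^sup>2" for z by simp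
  have "(norm (?G z))\<^sup>2 \<le> 8 * (norm (F z))\<^sup>2 + 1 * (norm (?K z))\<^sup>2" for z
  proof (cases "norm z \<le> 1/2")
    case True
    then have "(norm (?G z))\<^sup>2 \<le> B\<^sup>2" by (intro power_mono B) auto
    then show ?thesis unfolding K by (smt (verit) zero_le_power2)
  next
    case False
    then have "0 < norm z" by (cases "z = 0") auto
    with False have "norm (?G z) = norm (F z + - F 0) / norm z" "1 / norm z \<le> 2"
      by (auto simp: norm_divide pos_divide_le_eq)
    then have "norm (?G z) \<le> 2 * norm (F z + - F 0)"
      using mult_left_mono[of "1 / norm z" 2 "norm (F z + - F 0)"] by simp
    then have "(norm (?G z))\<^sup>2 \<le> (2 * norm (F z + - F 0))\<^sup>2" by (intro power_mono) auto
    then show ?thesis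
      unfolding K using norm_add_sq_le[of "F z" "- F 0"]
      by (smt (verit) zero_le_power2 norm_minus_cancel power_mult_distrib four_x_squared)
  qed
  from hardy_disc_dominated[OF G F hardy_disc_const this] show ?thesis by simp
qed

lemma radii_tendsto_1:
  fixes r :: "nat \<Rightarrow> real"
  defines "r \<equiv> \<lambda>n. 1 - inverse (real (Suc n))"
  shows "0 \<le> r n" "r n < 1" "filterlim r (at_left 1) sequentially"
proof -
  show r: "0 \<le> r n" "r n < 1" for n by (auto simp: r_def field_simps)
  show "filterlim r (at_left 1) sequentially"
    unfolding filterlim_at using r LIMSEQ_inverse_real_of_nat_add_minus[of 1]
    by (auto simp: r_def)
qed

text \<open>The mean value property holds on the circles of radius \<open>r < 1\<close> and survives the limit \<open>r \<rightarrow> 1\<close>,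
  because the dilated functions are bounded in \<open>L\<^sup>2\<close>.\<close>

lemma hardy_disc_value_0:
  assumes F: "F \<in> hardy_disc" "has_boundary F f"
  shows "F 0 = cinner f (l2_const 1)"
  using F(2)
proof (transfer fixing: F)
  fix f
  assume "l2_rel f f" and ae: "AE z in circ. ((\<lambda>r. F (of_real r * z)) \<longlongrightarrow> f z) (at_left (1::real))"
  then have f: "sq_integrable f" by (simp add: l2_rel_def)
  obtain C where C: "F holomorphic_on ball 0 1"
      "\<And>r. 0 \<le> r \<Longrightarrow> r < 1 \<Longrightarrow> (\<integral>z. (norm (F (of_real r * z)))\<^sup>2 \<partial>circ) \<le> C"
    using hardy_discD[OF F(1)] by metis
  define r where "r n = 1 - inverse (real (Suc n))" for n
  note r = radii_tendsto_1[folded r_def]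
  define h where "h n z = F (of_real (r n) * z) - f z" for n z
  have sF: "sq_integrable (\<lambda>z. F (of_real (r n) * z))" for n
    by (rule sq_integrable_dilate[OF C(1) r(1,2)])
  have sh: "sq_integrable (h n)" for n
    unfolding h_def by (rule sq_integrable_diff[OF sF f])
  have "(\<lambda>n. \<integral>z. h n z \<partial>circ) \<longlonglongrightarrow> 0"
  proof (rule L2_bounded_AE_tendsto_integral[OF finite_measure_circ])
    show "integrable circ (h n)" for n by (rule sq_integrable_integrable[OF sh])
    show "integrable circ (\<lambda>z. (norm (h n z))\<^sup>2)" for n
      using sh[of n] by (simp add: sq_integrable_def)
    show "AE z in circ. (\<lambda>n. h n z) \<longlonglongrightarrow> 0"
      using ae
    proof eventually_elim
      fix z assume "((\<lambda>r. F (of_real r * z)) \<longlongrightarrow> f z) (at_left (1::real))"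
      from filterlim_compose[OF this r(3)] show "(\<lambda>n. h n z) \<longlonglongrightarrow> 0"
        unfolding h_def by (simp add: LIM_zero_iff)
    qed
    fix n
    have "(\<integral>z. (norm (h n z))\<^sup>2 \<partial>circ) \<le>
        (\<integral>z. 2 * (norm (F (of_real (r n) * z)))\<^sup>2 + 2 * (norm (f z))\<^sup>2 \<partial>circ)"
      using sh[of n] sF[of n] f norm_add_sq_le[of _ "- f _"]
      by (intro integral_mono) (auto simp: sq_integrable_def h_def)
    also have "\<dots> = 2 * (\<integral>z. (norm (F (of_real (r n) * z)))\<^sup>2 \<partial>circ) + 2 * (\<integral>z. (norm (f z))\<^sup>2 \<partial>circ)"
      using sF[of n] f by (simp add: sq_integrable_def)
    also have "\<dots> \<le> 2 * C + 2 * (\<integral>z. (norm (f z))\<^sup>2 \<partial>circ)"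
      using C(2)[OF r(1,2), of n] by simp
    finally show "(\<integral>z. (norm (h n z))\<^sup>2 \<partial>circ) \<le> 2 * C + 2 * (\<integral>z. (norm (f z))\<^sup>2 \<partial>circ)" .
  qed
  moreover have "(\<integral>z. h n z \<partial>circ) = F 0 - (\<integral>z. f z \<partial>circ)" for n
    unfolding h_def
    using circ_mean_value[OF C(1) r(1,2), of n] sq_integrable_integrable[OF sF[of n]]
      sq_integrable_integrable[OF f] by simp
  ultimately show "F 0 = (\<integral>z. f z * cnj 1 \<partial>circ)"
    by (simp add: LIMSEQ_const_iff)
qed

section \<open>The Hardy space and the backward shift\<close>

lemma disc_fun:
  assumes "f \<in> H2"
  shows "disc_fun f \<in> hardy_disc" "has_boundary (disc_fun f) f"
proof -
  have "\<exists>F. F \<in> hardy_disc \<and> has_boundary F f" using assms by (auto simp: H2_def)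
  from someI_ex[OF this] show "disc_fun f \<in> hardy_disc" "has_boundary (disc_fun f) f"
    by (auto simp: disc_fun_def)
qed

lemma H2I: "F \<in> hardy_disc \<Longrightarrow> has_boundary F f \<Longrightarrow> f \<in> H2"
  by (auto simp: H2_def)

lemma disc_fun_0: "f \<in> H2 \<Longrightarrow> disc_fun f 0 = cinner f (l2_const 1)"
  by (intro hardy_disc_value_0 disc_fun)

lemma H2_const: "l2_const c \<in> H2"
  by (rule H2I[OF hardy_disc_const has_boundary_const])

lemma H2_add: "f \<in> H2 \<Longrightarrow> g \<in> H2 \<Longrightarrow> f + g \<in> H2"
  by (rule H2I[OF hardy_disc_add has_boundary_add]) (rule disc_fun; assumption)+

lemma H2_scale: "f \<in> H2 \<Longrightarrow> c *\<^sub>C f \<in> H2"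
  by (rule H2I[OF hardy_disc_mult_bounded[of _ "norm c"] has_boundary_scale]) (auto intro: disc_fun)

lemma H2_zero: "0 \<in> H2"
  using H2_scale[OF H2_const, of 0 1] by simp

lemma subspace_H2: "L2.subspace H2"
  by (rule L2.subspaceI) (auto intro: H2_zero H2_add H2_scale)

lemma closed_subspace_H2_span: "x \<in> H2 \<Longrightarrow> closed_subspace_H2 (L2.span {x})"
  unfolding closed_subspace_H2_def
  by (simp add: closed_span_singleton L2.span_minimal subspace_H2)

lemma sq_integrable_div_coord:
  assumes "sq_integrable f"
  shows "sq_integrable (\<lambda>z. f z / z)"
proof -
  have [measurable]: "(\<lambda>z. z) \<in> borel_measurable circ" "f \<in> borel_measurable circ"
    using assms borel_measurable_circ_continuous[of "\<lambda>z. z"] by (auto simp: sq_integrable_def)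
  have "integrable circ (\<lambda>z. (norm (f z / z))\<^sup>2) = integrable circ (\<lambda>z. (norm (f z))\<^sup>2)"
    by (rule Bochner_Integration.integrable_cong) (auto simp: space_circ norm_divide)
  then show ?thesis using assms by (simp add: sq_integrable_def)
qed

lift_definition l2_div_coord :: "l2_circle \<Rightarrow> l2_circle" is "\<lambda>f z. f z / z"
  by (auto simp: l2_rel_def sq_integrable_div_coord elim: AE_mp)

lemma l2_div_coord_scale: "l2_div_coord (c *\<^sub>C f) = c *\<^sub>C l2_div_coord f"
proof (transfer fixing: c)
  fix f assume "l2_rel f f"
  then have "sq_integrable (\<lambda>z. c * f z / z)"
    by (intro sq_integrable_div_coord[OF sq_integrable_scale]) (simp add: l2_rel_def)
  then show "l2_rel (\<lambda>z. c * f z / z) (\<lambda>z. c * (f z / z))" by (simp add: l2_rel_def)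
qed

lemma norm_l2_div_coord: "norm (l2_div_coord f) = norm f"
  unfolding norm_l2_circle_def
proof transfer
  fix f :: "complex \<Rightarrow> complex"
  have "(\<integral>z. f z / z * cnj (f z / z) \<partial>circ) = (\<integral>z. f z * cnj (f z) \<partial>circ)"
    by (rule Bochner_Integration.integral_cong[OF refl])
      (auto simp: space_circ complex_norm_square[symmetric] norm_divide simp del: of_real_power)
  then show "sqrt (Re (\<integral>z. f z / z * cnj (f z / z) \<partial>circ)) = sqrt (Re (\<integral>z. f z * cnj (f z) \<partial>circ))"
    by simp
qed

lemma has_boundary_difference_quotient:
  assumes "has_boundary F f"
  shows "has_boundary (\<lambda>z. if z = 0 then d else (F z - c) / z) (l2_div_coord (f - l2_const c))"
  using assms
proof (transfer fixing: F d c)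
  fix f assume "AE z in circ. ((\<lambda>r. F (of_real r * z)) \<longlongrightarrow> f z) (at_left (1::real))"
  then show "AE z in circ. ((\<lambda>r. if of_real r * z = 0 then d else (F (of_real r * z) - c) / (of_real r * z))
      \<longlongrightarrow> (f z - c) / z) (at_left (1::real))"
    using AE_circ_norm
  proof eventually_elim
    fix z :: complex
    assume *: "((\<lambda>r. F (of_real r * z)) \<longlongrightarrow> f z) (at_left (1::real))" "norm z = 1"
    have "((\<lambda>r. (F (of_real r * z) - c) / (of_real r * z)) \<longlongrightarrow> (f z - c) / (of_real 1 * z)) (at_left (1::real))"
      using * by (intro tendsto_intros) auto
    moreover have "eventually (\<lambda>r::real. 0 < r) (at_left 1)"
      using eventually_at_left_real[of 0 1, OF zero_less_one] by eventually_elim simp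
    then have "eventually (\<lambda>r. (F (of_real r * z) - c) / (of_real r * z) =
        (if of_real r * z = 0 then d else (F (of_real r * z) - c) / (of_real r * z))) (at_left (1::real))"
      by eventually_elim (use * in auto)
    ultimately show "((\<lambda>r. if of_real r * z = 0 then d else (F (of_real r * z) - c) / (of_real r * z))
      \<longlongrightarrow> (f z - c) / z) (at_left (1::real))"
      by (auto elim: Lim_transform_eventually)
  qed
qed

text \<open>The difference quotient keeps its form on the circle, and the subtracted value at \<open>0\<close> is the mean
  of \<open>f\<close>. So the backward shift becomes an operation on boundary functions, independent of the
  choice made by \<open>disc_fun\<close>.\<close>

lemma
  assumes "f \<in> H2"
  shows bshift_eq: "bshift f = l2_div_coord (f - l2_const (cinner f (l2_const 1)))"
    and bshift_H2: "bshift f \<in> H2"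
proof -
  note * = has_boundary_difference_quotient[OF disc_fun(2)[OF assms],
      of "deriv (disc_fun f) 0" "disc_fun f 0"]
  show "bshift f = l2_div_coord (f - l2_const (cinner f (l2_const 1)))"
    unfolding bshift_def using boundary_eqI[OF *] by (simp add: disc_fun_0[OF assms])
  then show "bshift f \<in> H2"
    using H2I[OF hardy_disc_difference_quotient[OF disc_fun(1)[OF assms]] *]
    by (simp add: disc_fun_0[OF assms])
qed

lemma bshift_scale:
  assumes "f \<in> H2"
  shows "bshift (c *\<^sub>C f) = c *\<^sub>C bshift f"
proof -
  have "c *\<^sub>C f - l2_const (cinner (c *\<^sub>C f) (l2_const 1)) =
      c *\<^sub>C (f - l2_const (cinner f (l2_const 1)))"
    by (subst (1 2) l2_const_eq_scale)
      (simp add: cinner_scale_left L2.scale_right_diff_distrib)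
  then show ?thesis
    by (simp add: bshift_eq assms H2_scale l2_div_coord_scale)
qed

lemma bshift_const: "bshift (l2_const c) = 0"
proof -
  have "cinner (l2_const c) (l2_const 1) = c"
    by (subst l2_const_eq_scale) (simp add: cinner_scale_left cinner_self norm_l2_const_1)
  then have "norm (bshift (l2_const c)) = 0"
    by (simp add: bshift_eq H2_const norm_l2_div_coord)
  then show ?thesis by simp
qed

lemma norm_bshift:
  assumes "f \<in> H2" "cinner f (l2_const 1) = 0"
  shows "norm (bshift f) = norm f"
  by (simp add: l2_const_0 bshift_eq assms norm_l2_div_coord)

section \<open>Multiplication by an inner function\<close>

lift_definition unimodular :: "l2_circle \<Rightarrow> bool" is "\<lambda>g. AE z in circ. norm (g z) = 1"
proof -
  fix f g assume "l2_rel f g"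
  then have "AE z in circ. f z = g z" by (auto simp: l2_rel_def)
  then have "AE z in circ. norm (f z) = 1 \<longleftrightarrow> norm (g z) = 1"
    by eventually_elim simp
  then show "(AE z in circ. norm (f z) = 1) = (AE z in circ. norm (g z) = 1)"
    by (rule eventually_subst)
qed

lemma sq_integrable_mult_unimodular:
  assumes "g \<in> borel_measurable circ" "AE z in circ. norm (g z) = 1" "sq_integrable f"
  shows "sq_integrable (\<lambda>z. g z * f z)"
proof -
  have [measurable]: "g \<in> borel_measurable circ" "f \<in> borel_measurable circ"
    using assms by (auto simp: sq_integrable_def)
  have "AE z in circ. (norm (g z * f z))\<^sup>2 = (norm (f z))\<^sup>2"
    using assms(2) by eventually_elim (simp add: norm_mult)
  then have "integrable circ (\<lambda>z. (norm (g z * f z))\<^sup>2) = integrable circ (\<lambda>z. (norm (f z))\<^sup>2)"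
    by (intro integrable_cong_AE) auto
  then show ?thesis using assms(3) by (simp add: sq_integrable_def)
qed

lemma l2_rel_mult_unimodular:
  assumes "l2_rel g g" "AE z in circ. norm (g z) = 1" "l2_rel f f"
  shows "sq_integrable (\<lambda>z. g z * f z)" "sq_integrable (\<lambda>z. cnj (g z) * f z)"
proof -
  have "g \<in> borel_measurable circ" "(\<lambda>z. cnj (g z)) \<in> borel_measurable circ" "sq_integrable f"
    using assms sq_integrable_cnj[of g] by (auto simp: l2_rel_def sq_integrable_def)
  then show "sq_integrable (\<lambda>z. g z * f z)" "sq_integrable (\<lambda>z. cnj (g z) * f z)"
    using assms(2) by (auto intro!: sq_integrable_mult_unimodular)
qed

text \<open>As a product that is not square integrable is \<open>0\<close> by convention, cancellation has to check that
  both products are genuine; unimodularity ensures this.\<close>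

lemma l2_mult_cnj_cancel:
  assumes "unimodular g"
  shows "g \<cdot> (l2_cnj g \<cdot> f) = f" "l2_cnj g \<cdot> (g \<cdot> f) = f"
proof -
  show "g \<cdot> (l2_cnj g \<cdot> f) = f" using assms
  proof transfer
    fix f g assume *: "l2_rel g g" "AE z in circ. norm (g z) = 1" "l2_rel f f"
    have "l2_rel (\<lambda>z. cnj (g z) * f z) (\<lambda>z. cnj (g z) * f z)"
      using l2_rel_mult_unimodular(2)[OF *] by (simp add: l2_rel_def)
    note s = l2_rel_mult_unimodular(2)[OF *] l2_rel_mult_unimodular(1)[OF *(1,2) this]
    have "AE z in circ. g z * (cnj (g z) * f z) = f z"
      using *(2) by eventually_elim (simp add: complex_norm_square[symmetric] flip: mult.assoc)
    then show "l2_rel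
        (if sq_integrable (\<lambda>z. g z * (if sq_integrable (\<lambda>z. cnj (g z) * f z)
               then \<lambda>z. cnj (g z) * f z else (\<lambda>_. 0)) z)
         then \<lambda>z. g z * (if sq_integrable (\<lambda>z. cnj (g z) * f z)
               then \<lambda>z. cnj (g z) * f z else (\<lambda>_. 0)) z
         else (\<lambda>_. 0)) f"
      using s *(3) by (simp add: l2_rel_def)
  qed
  show "l2_cnj g \<cdot> (g \<cdot> f) = f" using assms
  proof transfer
    fix f g assume *: "l2_rel g g" "AE z in circ. norm (g z) = 1" "l2_rel f f"
    have "l2_rel (\<lambda>z. g z * f z) (\<lambda>z. g z * f z)"
      using l2_rel_mult_unimodular(1)[OF *] by (simp add: l2_rel_def)
    note s = l2_rel_mult_unimodular(1)[OF *] l2_rel_mult_unimodular(2)[OF *(1,2) this]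
    have "AE z in circ. cnj (g z) * (g z * f z) = f z"
      using *(2)
      by eventually_elim
        (simp add: complex_norm_square[symmetric] mult.commute[of "cnj _"] flip: mult.assoc)
    then show "l2_rel
        (if sq_integrable (\<lambda>z. cnj (g z) * (if sq_integrable (\<lambda>z. g z * f z)
               then \<lambda>z. g z * f z else (\<lambda>_. 0)) z)
         then \<lambda>z. cnj (g z) * (if sq_integrable (\<lambda>z. g z * f z)
               then \<lambda>z. g z * f z else (\<lambda>_. 0)) z
         else (\<lambda>_. 0)) f"
      using s *(3) by (simp add: l2_rel_def)
  qed
qed

lemma norm_unimodular_mult:
  assumes "unimodular g"
  shows "norm (g \<cdot> f) = norm f"
  unfolding norm_l2_circle_def using assms
proof transfer
  fix f g assume *: "l2_rel g g" "AE z in circ. norm (g z) = 1" "l2_rel f f"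
  note s = l2_rel_mult_unimodular(1)[OF *]
  have "AE z in circ. g z * f z * cnj (g z * f z) = f z * cnj (f z)"
    using *(2) by eventually_elim
      (simp add: complex_norm_square[symmetric] norm_mult del: complex_cnj_mult of_real_power)
  then have "(\<integral>z. g z * f z * cnj (g z * f z) \<partial>circ) = (\<integral>z. f z * cnj (f z) \<partial>circ)"
    using sq_integrable_inner[OF s s] l2_sq_integrable_product[OF *(3,3)]
    by (intro integral_cong_AE) auto
  then show "sqrt (Re (\<integral>z. (if sq_integrable (\<lambda>z. g z * f z) then \<lambda>z. g z * f z else (\<lambda>_. 0)) z *
      cnj ((if sq_integrable (\<lambda>z. g z * f z) then \<lambda>z. g z * f z else (\<lambda>_. 0)) z) \<partial>circ)) =
      sqrt (Re (\<integral>z. f z * cnj (f z) \<partial>circ))"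
    using s by simp
qed

lemma l2_mult_scale_right:
  assumes "unimodular g"
  shows "g \<cdot> (c *\<^sub>C f) = c *\<^sub>C (g \<cdot> f)"
  using assms
proof (transfer fixing: c)
  fix f g assume *: "l2_rel g g" "AE z in circ. norm (g z) = 1" "l2_rel f f"
  have "l2_rel (\<lambda>z. c * f z) (\<lambda>z. c * f z)"
    using *(3) sq_integrable_scale by (simp add: l2_rel_def)
  from l2_rel_mult_unimodular(1)[OF *] l2_rel_mult_unimodular(1)[OF *(1,2) this]
  show "l2_rel (if sq_integrable (\<lambda>z. g z * (c * f z)) then \<lambda>z. g z * (c * f z) else (\<lambda>_. 0))
      (\<lambda>z. c * (if sq_integrable (\<lambda>z. g z * f z) then \<lambda>z. g z * f z else (\<lambda>_. 0)) z)"
    by (simp add: l2_rel_def mult.left_commute)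
qed

lemma has_boundary_mult:
  assumes "has_boundary G g" "unimodular g" "has_boundary F f"
  shows "has_boundary (\<lambda>z. G z * F z) (g \<cdot> f)"
  using assms
proof (transfer fixing: G F)
  fix f g
  assume *: "l2_rel g g" "AE z in circ. norm (g z) = 1" "l2_rel f f"
    and "AE z in circ. ((\<lambda>r. G (of_real r * z)) \<longlongrightarrow> g z) (at_left (1::real))"
      "AE z in circ. ((\<lambda>r. F (of_real r * z)) \<longlongrightarrow> f z) (at_left (1::real))"
  from this(4,5)
  have "AE z in circ. ((\<lambda>r. G (of_real r * z) * F (of_real r * z)) \<longlongrightarrow> g z * f z) (at_left (1::real))"
    by eventually_elim (rule tendsto_mult)
  then show "AE z in circ. ((\<lambda>r. G (of_real r * z) * F (of_real r * z)) \<longlongrightarrow>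
      (if sq_integrable (\<lambda>z. g z * f z) then \<lambda>z. g z * f z else (\<lambda>_. 0)) z) (at_left (1::real))"
    using l2_rel_mult_unimodular(1)[OF *] by simp
qed

text \<open>An inner function is only given to have unimodular limits at almost every point; measurability of
  the boundary function comes from writing it as the limit along one sequence of radii.\<close>

lemma inner_function_boundary:
  assumes "inner_function \<theta>"
  shows "has_boundary \<theta> (boundary \<theta>)" "unimodular (boundary \<theta>)"
proof -
  have hol: "\<theta> holomorphic_on ball 0 1"
    and ae: "AE z in circ. \<exists>l. norm l = 1 \<and> ((\<lambda>r. \<theta> (of_real r * z)) \<longlongrightarrow> l) (at_left (1::real))"
    using assms by (auto simp: inner_function_def)
  define r where "r n = 1 - inverse (real (Suc n))" for n
  note r = radii_tendsto_1[folded r_def]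
  define g where "g z = lim (\<lambda>n. \<theta> (of_real (r n) * z))" for z
  have lim: "AE z in circ. norm (g z) = 1 \<and> ((\<lambda>r. \<theta> (of_real r * z)) \<longlongrightarrow> g z) (at_left (1::real))"
    using ae
  proof eventually_elim
    fix z assume "\<exists>l. norm l = 1 \<and> ((\<lambda>r. \<theta> (of_real r * z)) \<longlongrightarrow> l) (at_left (1::real))"
    then obtain l where l: "norm l = 1" "((\<lambda>r. \<theta> (of_real r * z)) \<longlongrightarrow> l) (at_left (1::real))"
      by blast
    from filterlim_compose[OF l(2) r(3)] have "g z = l"
      unfolding g_def by (rule limI)
    with l show "norm (g z) = 1 \<and> ((\<lambda>r. \<theta> (of_real r * z)) \<longlongrightarrow> g z) (at_left (1::real))"
      by simp
  qed
  have "g \<in> borel_measurable circ"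
    unfolding g_def
    by (intro borel_measurable_lim_metric borel_measurable_circ_continuous
        continuous_on_dilate hol r)
  then have g: "sq_integrable g"
    using lim by (auto intro: sq_integrable_AE_bounded[of _ 1])
  have "\<exists>h. has_boundary \<theta> h \<and> unimodular h"
  proof (transfer fixing: \<theta>)
    show "\<exists>h\<in>{h. l2_rel h h}. (AE z in circ. ((\<lambda>r. \<theta> (of_real r * z)) \<longlongrightarrow> h z) (at_left (1::real)))
        \<and> (AE z in circ. norm (h z) = 1)"
      using g lim by (intro bexI[of _ g]) (auto simp: l2_rel_def)
  qed
  then show "has_boundary \<theta> (boundary \<theta>)" "unimodular (boundary \<theta>)"
    using boundary_eqI by auto
qed

lemma inner_function_bounded:
  assumes "inner_function \<theta>"
  obtains B where "\<And>z. norm z < 1 \<Longrightarrow> norm (\<theta> z) \<le> B"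
proof -
  from assms obtain B where "\<forall>y\<in>\<theta> ` ball 0 1. norm y \<le> B"
    unfolding inner_function_def bounded_iff by blast
  then show ?thesis by (intro that[of B]) auto
qed

lemma H2_inner_function_mult:
  assumes "inner_function \<theta>" "f \<in> H2"
  shows "boundary \<theta> \<cdot> f \<in> H2"
proof -
  obtain B where "\<And>z. norm z < 1 \<Longrightarrow> norm (\<theta> z) \<le> B"
    using inner_function_bounded[OF assms(1)] by metis
  moreover have "\<theta> holomorphic_on ball 0 1" using assms(1) by (simp add: inner_function_def)
  ultimately show ?thesis
    using inner_function_boundary[OF assms(1)] disc_fun[OF assms(2)]
    by (blast intro: H2I hardy_disc_mult_bounded has_boundary_mult)
qed

lemma toeplitz_inner_function:
  "inner_function \<theta> \<Longrightarrow> f \<in> H2 \<Longrightarrow> toeplitz (boundary \<theta>) f = boundary \<theta> \<cdot> f"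
  unfolding toeplitz_def by (intro orth_proj_mem subspace_H2 H2_inner_function_mult)

section \<open>Invariant and nearly invariant subspaces\<close>

lemma bshift2_invariant_const: "bshift2_invariant_subspace (range l2_const \<times> {0})"
  unfolding bshift2_invariant_subspace_def
proof (intro conjI)
  show "range l2_const \<times> {0} \<subseteq> H2 \<times> H2" using H2_const H2_zero by auto
  have "L2.subspace (range l2_const)" unfolding range_l2_const by (rule L2.subspace_span)
  then show "L2_pair.subspace (range l2_const \<times> {0})"
    unfolding L2.subspace_def L2_pair.subspace_def
    by (auto simp: pair_scale_def zero_prod_def)
  show "closed (range l2_const \<times> {0::l2_circle})"
    unfolding range_l2_const by (intro closed_Times closed_span_singleton closed_singleton)
  have "0 \<in> range l2_const" using l2_const_0 by (rule range_eqI[OF sym])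
  then show "\<forall>(k, l)\<in>range l2_const \<times> {0}. (bshift k, bshift l) \<in> range l2_const \<times> {0}"
    using bshift_const bshift_const[of 0] unfolding l2_const_0 by auto
qed

lemma bshift_invariant_const: "bshift_invariant_subspace (range l2_const)"
proof -
  have "0 \<in> range l2_const" using l2_const_0 by (rule range_eqI[OF sym])
  moreover have "closed_subspace_H2 (range l2_const)"
    unfolding range_l2_const by (rule closed_subspace_H2_span[OF H2_const])
  ultimately show ?thesis
    by (auto simp: bshift_invariant_subspace_def bshift_const)
qed

lemma nearly_invariant_span:
  assumes w: "w \<in> H2" and F: "F \<subseteq> H2" "L2.subspace F" "bshift w \<in> F"
  shows "nearly_invariant_modulo (L2.span {w}) F"
  unfolding nearly_invariant_modulo_def
proof (intro conjI ballI impI)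
  fix f assume "f \<in> L2.span {w}"
  then obtain c where "f = c *\<^sub>C w" by (auto simp: L2.span_singleton)
  then have "bshift f = 0 + c *\<^sub>C bshift w" using bshift_scale[OF w] by simp
  then show "\<exists>g\<in>L2.span {w}. \<exists>h\<in>F. bshift f = g + h"
    using F L2.subspace_scale L2.span_zero by blast
qed (use closed_subspace_H2_span[OF w] F in auto)

text \<open>If \<open>S\<^sup>* w = 0\<close>, the line through \<open>S\<^sup>* w\<close> degenerates, and any line in \<open>H2\<close> can serve as the defect
  space; the constants are taken.\<close>

lemma nearly_invariant_defect_1:
  assumes w: "w \<in> H2"
  shows "nearly_invariant_with_defect (L2.span {w}) 1"
proof -
  define b where "b = (if bshift w = 0 then l2_const 1 else bshift w)"
  have b: "b \<noteq> 0" "b \<in> H2" using norm_l2_const_1 H2_const bshift_H2[OF w] by (auto simp: b_def)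
  have "bshift w \<in> L2.span {b}" by (auto simp: b_def L2.span_zero intro: L2.span_base)
  then have "nearly_invariant_modulo (L2.span {w}) (L2.span {b})"
    using b by (intro nearly_invariant_span w L2.span_minimal subspace_H2) auto
  then show ?thesis
    unfolding nearly_invariant_with_defect_def using has_dim_span_singleton[OF b(1)] by blast
qed

section \<open>The kernel of the perturbed Toeplitz operator\<close>

lemma scaled_span_singleton:
  assumes "c \<noteq> 0"
  shows "L2.span {w} = range (\<lambda>k. k *\<^sub>C (c *\<^sub>C w))"
proof -
  have "range (\<lambda>k. k * c) = UNIV" using assms by (intro surjI[of _ "\<lambda>k. k / c"]) simp
  then show ?thesis
    using image_image[of "\<lambda>k. k *\<^sub>C w" "\<lambda>k. k * c" UNIV] by (simp add: L2.span_singleton)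
qed

text \<open>Cancelling \<open>\<theta>\<close> in \<open>\<theta> f = - \<langle>f, u\<rangle> v\<close> puts the kernel on the line through \<open>w\<close>. The condition on
  \<open>\<langle>w, u\<rangle>\<close> is what makes \<open>w\<close> itself a solution; otherwise only \<open>f = 0\<close> would remain.\<close>

lemma toeplitz_perturbation_kernel:
  assumes \<theta>: "inner_function \<theta>" and w: "w = l2_cnj (boundary \<theta>) \<cdot> v" "w \<in> H2"
    and w_u: "1 + cinner w u = 0"
  shows "{f \<in> H2. toeplitz (boundary \<theta>) f + cinner f u *\<^sub>C v = 0} = L2.span {w}"
proof (intro subset_antisym subsetI)
  note uni = inner_function_boundary(2)[OF \<theta>]
  note cancel = l2_mult_cnj_cancel[OF uni]
  fix f assume "f \<in> {f \<in> H2. toeplitz (boundary \<theta>) f + cinner f u *\<^sub>C v = 0}"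
  then have "boundary \<theta> \<cdot> f = (- cinner f u) *\<^sub>C v"
    using toeplitz_inner_function[OF \<theta>, of f] by (simp add: eq_neg_iff_add_eq_0)
  also have "\<dots> = boundary \<theta> \<cdot> ((- cinner f u) *\<^sub>C w)"
    by (subst l2_mult_scale_right[OF uni]) (simp add: w(1) cancel(1))
  finally have "f = (- cinner f u) *\<^sub>C w" using cancel(2) by metis
  then show "f \<in> L2.span {w}" unfolding L2.span_singleton by blast
next
  note uni = inner_function_boundary(2)[OF \<theta>]
  fix f assume "f \<in> L2.span {w}"
  then obtain c where f: "f = c *\<^sub>C w" by (auto simp: L2.span_singleton)
  have "f \<in> H2" using f H2_scale w by simp
  moreover have "boundary \<theta> \<cdot> f = c *\<^sub>C v"
    using l2_mult_cnj_cancel(1)[OF uni] w(1) by (simp add: f l2_mult_scale_right[OF uni])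
  moreover have "cinner w u = - 1" using w_u by (simp add: eq_neg_iff_add_eq_0 add.commute)
  then have "cinner f u = - c" by (simp add: f cinner_scale_left)
  ultimately show "f \<in> {f \<in> H2. toeplitz (boundary \<theta>) f + cinner f u *\<^sub>C v = 0}"
    by (simp add: toeplitz_inner_function[OF \<theta>])
qed

theorem corollary3p5:
  fixes \<theta> :: "complex \<Rightarrow> complex" and u v w :: l2_circle and a\<^sub>0 :: complex
    and R\<^sub>1 :: "l2_circle \<Rightarrow> l2_circle" and M :: "l2_circle set"
  assumes \<theta>: "inner_function \<theta>"
    and u: "u \<in> H2" "norm u = 1"
    and v: "v \<in> H2" "bshift v \<noteq> 0"
    and R\<^sub>1: "R\<^sub>1 = (\<lambda>f. toeplitz (boundary \<theta>) f + cinner f u *\<^sub>C v)"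
    and w: "w = l2_cnj (boundary \<theta>) \<cdot> v"
    and w_H2: "w \<in> H2"
    and w_u: "1 + cinner w u = 0"
    and M: "M = {f \<in> H2. R\<^sub>1 f = 0}"
    and a\<^sub>0: "a\<^sub>0 = cinner w (l2_const 1)"
  shows "M = L2.span {w}
    \<and> nearly_invariant_with_defect M 1
    \<and> nearly_invariant_modulo M (L2.span {bshift w})
    \<and> (bshift w \<noteq> 0 \<longrightarrow> has_dim (L2.span {bshift w}) 1)
    \<and> (a\<^sub>0 \<noteq> 0 \<longrightarrow>
        (let f\<^sub>0 = orth_proj M (l2_const 1); K = range l2_const \<times> {0} in
          f\<^sub>0 = (cnj a\<^sub>0 / of_real ((norm v)\<^sup>2)) *\<^sub>C w
          \<and> bshift2_invariant_subspace K
          \<and> M = {f. \<exists>k\<^sub>0. f = k\<^sub>0 \<cdot> f\<^sub>0 \<and> (k\<^sub>0, 0) \<in> K}))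
    \<and> (a\<^sub>0 = 0 \<longrightarrow>
        (let K = range l2_const in
          bshift w \<noteq> 0
          \<and> bshift_invariant_subspace K
          \<and> M = {f. \<exists>k\<^sub>1\<in>K. f = of_real (1 / norm (bshift w)) *\<^sub>C (k\<^sub>1 \<cdot> w)}))"
proof -
  note uni = inner_function_boundary(2)[OF \<theta>]
  have M_span: "M = L2.span {w}"
    unfolding M R\<^sub>1 by (rule toeplitz_perturbation_kernel[OF \<theta> w w_H2 w_u])
  have "w \<noteq> 0" using w_u cinner_scale_left[of 0 0 u] by auto
  have norm_w: "norm w = norm v"
    using norm_unimodular_mult[OF uni, of w] l2_mult_cnj_cancel(1)[OF uni, of v] by (simp add: w)
  have case1: "f\<^sub>0 = (cnj a\<^sub>0 / of_real ((norm v)\<^sup>2)) *\<^sub>C w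
      \<and> M = {f. \<exists>k\<^sub>0. f = k\<^sub>0 \<cdot> f\<^sub>0 \<and> (k\<^sub>0, 0) \<in> range l2_const \<times> {0::l2_circle}}"
    if "a\<^sub>0 \<noteq> 0" and f\<^sub>0: "f\<^sub>0 = orth_proj M (l2_const 1)" for f\<^sub>0
  proof
    have "cinner (l2_const 1) w = cnj a\<^sub>0" unfolding a\<^sub>0 by (rule cinner_commute)
    then show f\<^sub>0_eq: "f\<^sub>0 = (cnj a\<^sub>0 / of_real ((norm v)\<^sup>2)) *\<^sub>C w"
      by (simp add: f\<^sub>0 M_span orth_proj_span_singleton norm_w)
    have "norm v \<noteq> 0" unfolding norm_w[symmetric] using \<open>w \<noteq> 0\<close> by simp
    then have "M = range (\<lambda>c. l2_const c \<cdot> f\<^sub>0)"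
      unfolding l2_const_mult M_span f\<^sub>0_eq using \<open>a\<^sub>0 \<noteq> 0\<close> by (intro scaled_span_singleton) auto
    then show "M = {f. \<exists>k\<^sub>0. f = k\<^sub>0 \<cdot> f\<^sub>0 \<and> (k\<^sub>0, 0) \<in> range l2_const \<times> {0::l2_circle}}"
      by blast
  qed
  have case2: "bshift w \<noteq> 0
      \<and> M = {f. \<exists>k\<^sub>1\<in>range l2_const. f = of_real (1 / norm (bshift w)) *\<^sub>C (k\<^sub>1 \<cdot> w)}"
    if "a\<^sub>0 = 0"
  proof
    have "norm (bshift w) = norm w" using norm_bshift[OF w_H2] that a\<^sub>0 by simp
    then show nz: "bshift w \<noteq> 0" using \<open>w \<noteq> 0\<close> by auto
    have "M = range (\<lambda>k. k *\<^sub>C (of_real (1 / norm (bshift w)) *\<^sub>C w))"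
      unfolding M_span using nz by (intro scaled_span_singleton) auto
    also have "\<dots> = {f. \<exists>k\<^sub>1\<in>range l2_const. f = of_real (1 / norm (bshift w)) *\<^sub>C (k\<^sub>1 \<cdot> w)}"
      by (auto simp: l2_const_mult mult.commute)
    finally show "M = \<dots>" .
  qed
  have defect_space: "nearly_invariant_modulo M (L2.span {bshift w})"
    unfolding M_span using bshift_H2[OF w_H2]
    by (intro nearly_invariant_span w_H2 L2.span_minimal subspace_H2) (auto intro: L2.span_base)
  have defect: "nearly_invariant_with_defect M 1"
    unfolding M_span by (rule nearly_invariant_defect_1[OF w_H2])
  show ?thesis
    unfolding Let_def
    by (intro conjI impI; rule M_span defect defect_space has_dim_span_singleton
        bshift2_invariant_const bshift_invariant_const case1[OF _ refl, THEN conjunct1]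
        case1[OF _ refl, THEN conjunct2] case2[THEN conjunct1] case2[THEN conjunct2]; assumption)
qed

end
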